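(* For every $k\ge1$, the generating function of the basis elements of $\bigwedge^kV^*$ is $$\sum_{\nu\in\mathcal P_k}s_\nu(\mathbf w_k^{-1})\,[\boldsymbol\beta]^k_\nu=\frac{\prod_{j=1}^kw_j^{k-1}}{\Delta_0(\mathbf w_k)}\;\boldsymbol\beta(w_k^{-1})\wedge\cdots\wedge\boldsymbol\beta(w_1^{-1}),$$ where $\Delta_0(\mathbf w_k)=\prod_{1\le i<j\le k}(w_j-w_i)$.
   Context: $V^*=\bigoplus_{j\ge0}\mathbb Q\beta_j$ is a $\mathbb Q$-vector space with basis $(\beta_j)_{j\ge0}$ (the restricted dual of $V=\bigoplus_{i\ge0}\mathbb Qb_i$, with $\beta_j(b_i)=\delta_{ij}$), and $\boldsymbol\beta(w^{-1})=\sum_{j\ge0}\beta_jw^{-j}$. $\mathcal P_k$ is the set of partitions of length at most $k$ (padded by zeros). For $\nu\in\mathcal P_k$, $[\boldsymbol\beta]^k_\nu=\beta_{k-1+\nu_1}\wedge\beta_{k-2+\nu_2}\wedge\cdots\wedge\beta_{\nu_k}\in\bigwedge^kV^*$; these elements form a basis of $\bigwedge^kV^*$. $\mathbf w_k=(w_1,\dots,w_k)$ are formal variables, $\mathbf w_k^{-1}=(w_1^{-1},\dots,w_k^{-1})$, and $s_\nu(\mathbf x_k)=\det\big(x_j^{\nu_{k-i+1}+i-1}\big)_{1\le i,j\le k}\big/\prod_{i<j}(x_j-x_i)$ is the Schur polynomial.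
   Formalization: The right-hand side carries an extra factor (-1)^{k(k-1)/2}: as printed the identity is off by this sign (k=2, coefficient of β_1∧β_0: left side 1, right side -1); for k ≡ 0,1 mod 4 it is the printed formula. *)

theory Defs
  imports
    "HOL-Library.Poly_Mapping"
    "HOL-Computational_Algebra.Fraction_Field"
    "Jordan_Normal_Form.Determinant"
begin

section \<open>The exterior algebra of \<open>V\<^sup>*\<close>\<close>

type_synonym vdual = "nat \<Rightarrow>\<^sub>0 rat"

definition \<beta> :: "nat \<Rightarrow> vdual" where
  "\<beta> j = Poly_Mapping.single j 1"

text \<open>
  The tensor algebra of a vector space with basis \<open>(\<beta>\<^sub>j)\<close> is the free associative algebra on the
  \<open>\<beta>\<^sub>j\<close>, i.e. the monoid algebra of the free monoid of words: \<open>Word [j\<^sub>1, \<dots>, j\<^sub>n]\<close> stands for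
  \<open>\<beta>\<^bsub>j\<^sub>1\<^esub> \<otimes> \<dots> \<otimes> \<beta>\<^bsub>j\<^sub>n\<^esub>\<close>, and multiplication is \<open>\<otimes>\<close>.
\<close>

datatype word = Word (letters: "nat list")

instantiation word :: monoid_add
begin
definition zero_word :: word where "0 = Word []"
definition plus_word :: "word \<Rightarrow> word \<Rightarrow> word" where "u + v = Word (letters u @ letters v)"
instance by standard (auto simp: zero_word_def plus_word_def)
end

type_synonym tensor = "word \<Rightarrow>\<^sub>0 rat"

definition tensor_of :: "vdual \<Rightarrow> tensor" where
  "tensor_of v = (\<Sum>j\<in>Poly_Mapping.keys v. Poly_Mapping.single (Word [j]) (Poly_Mapping.lookup v j))"

text \<open>The two-sided ideal generated by all \<open>v \<otimes> v\<close>.\<close>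

inductive_set ext_ideal :: "tensor set" where
  zero: "0 \<in> ext_ideal"
| step: "x \<in> ext_ideal \<Longrightarrow> x + a * (tensor_of v * tensor_of v) * b \<in> ext_ideal"

lemma ext_ideal_add:
  assumes "x \<in> ext_ideal" and "y \<in> ext_ideal"
  shows "x + y \<in> ext_ideal"
  using assms(2)
proof (induction y rule: ext_ideal.induct)
  case (step y a v b)
  then show ?case
    using ext_ideal.step[OF step.IH, of a v b] by (simp add: add.assoc)
qed (simp add: assms(1))

lemma ext_ideal_mult_left: "x \<in> ext_ideal \<Longrightarrow> c * x \<in> ext_ideal"
proof (induction x rule: ext_ideal.induct)
  case (step x a v b)
  have "c * (x + a * (tensor_of v * tensor_of v) * b) =
          c * x + (c * a) * (tensor_of v * tensor_of v) * b"
    by (simp add: algebra_simps)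
  then show ?case using ext_ideal.step[OF step.IH] by simp
qed (simp add: ext_ideal.zero)

lemma ext_ideal_mult_right: "x \<in> ext_ideal \<Longrightarrow> x * c \<in> ext_ideal"
proof (induction x rule: ext_ideal.induct)
  case (step x a v b)
  have "(x + a * (tensor_of v * tensor_of v) * b) * c =
          x * c + a * (tensor_of v * tensor_of v) * (b * c)"
    by (simp add: algebra_simps)
  then show ?case using ext_ideal.step[OF step.IH] by simp
qed (simp add: ext_ideal.zero)

lemma ext_ideal_uminus: "x \<in> ext_ideal \<Longrightarrow> - x \<in> ext_ideal"
  using ext_ideal_mult_left[of x "- 1"] by simp

lemma word_sum_zero: "(0 = u + v) = (u = 0 \<and> v = (0::word))"
  by (cases u; cases v) (auto simp: zero_word_def plus_word_def)

lemma lookup_tensor_mult_zero: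
  "Poly_Mapping.lookup (x * y) (0::word) =
     Poly_Mapping.lookup x 0 * (Poly_Mapping.lookup y 0 :: rat)"
proof -
  have "(\<Sum>q. Poly_Mapping.lookup y q when 0 = l + q) =
          (Poly_Mapping.lookup y 0 when l = 0)" for l :: word
    by (cases "l = 0") (simp_all add: word_sum_zero)
  then show ?thesis
    by (simp add: lookup_mult mult_when)
qed

lemma lookup_tensor_of_zero: "Poly_Mapping.lookup (tensor_of v) 0 = 0"
  by (simp add: tensor_of_def lookup_sum lookup_single zero_word_def)

lemma ext_ideal_lookup_zero: "x \<in> ext_ideal \<Longrightarrow> Poly_Mapping.lookup x 0 = 0"
  by (induction x rule: ext_ideal.induct)
     (simp_all add: lookup_add lookup_tensor_mult_zero lookup_tensor_of_zero)

definition ext_rel :: "tensor \<Rightarrow> tensor \<Rightarrow> bool" where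
  "ext_rel x y \<longleftrightarrow> x - y \<in> ext_ideal"

text \<open>\<open>\<And>V\<^sup>* = T(V\<^sup>*) / (v \<otimes> v)\<close>; its multiplication is the wedge product, and \<open>\<And>\<^sup>k V\<^sup>*\<close> is
  its homogeneous component of degree \<open>k\<close>.\<close>

quotient_type ext = tensor / ext_rel
proof (rule equivpI)
  show "reflp ext_rel"
    by (simp add: reflp_def ext_rel_def ext_ideal.zero)
  show "symp ext_rel"
    using ext_ideal_uminus by (fastforce simp: symp_def ext_rel_def)
  show "transp ext_rel"
    using ext_ideal_add by (fastforce simp: transp_def ext_rel_def)
qed

instantiation ext :: ring_1
begin

lift_definition zero_ext :: ext is 0 .
lift_definition one_ext :: ext is 1 .

lift_definition plus_ext :: "ext \<Rightarrow> ext \<Rightarrow> ext" is "(+)"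
proof -
  fix a b c d assume "ext_rel a b" "ext_rel c d"
  moreover have "(a + c) - (b + d) = (a - b) + (c - d)" by simp
  ultimately show "ext_rel (a + c) (b + d)"
    unfolding ext_rel_def by (metis ext_ideal_add)
qed

lift_definition uminus_ext :: "ext \<Rightarrow> ext" is uminus
proof -
  fix a b assume "ext_rel a b"
  moreover have "(- a) - (- b) = - (a - b)" by simp
  ultimately show "ext_rel (- a) (- b)"
    unfolding ext_rel_def by (metis ext_ideal_uminus)
qed

lift_definition minus_ext :: "ext \<Rightarrow> ext \<Rightarrow> ext" is "(-)"
proof -
  fix a b c d assume "ext_rel a b" "ext_rel c d"
  moreover have "(a - c) - (b - d) = (a - b) + - (c - d)" by simp
  ultimately show "ext_rel (a - c) (b - d)"
    unfolding ext_rel_def by (metis ext_ideal_add ext_ideal_uminus)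
qed

lift_definition times_ext :: "ext \<Rightarrow> ext \<Rightarrow> ext" is "(*)"
proof -
  fix a b c d assume "ext_rel a b" "ext_rel c d"
  moreover have "a * c - b * d = (a - b) * c + b * (c - d)" by (simp add: algebra_simps)
  ultimately show "ext_rel (a * c) (b * d)"
    unfolding ext_rel_def
    by (metis ext_ideal_add ext_ideal_mult_left ext_ideal_mult_right)
qed

lemma ext_rel_eq: "x = y \<Longrightarrow> ext_rel x y"
  by (simp add: ext_rel_def ext_ideal.zero)

instance
proof
  fix a b c :: ext
  show "a + b + c = a + (b + c)" by (transfer, rule ext_rel_eq, rule add.assoc)
  show "a + b = b + a" by (transfer, rule ext_rel_eq, rule add.commute)
  show "0 + a = a" by (transfer, rule ext_rel_eq, rule add_0_left)
  show "- a + a = 0" by (transfer, rule ext_rel_eq, rule left_minus)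
  show "a - b = a + - b" by (transfer, rule ext_rel_eq, rule diff_conv_add_uminus)
  show "a * b * c = a * (b * c)" by (transfer, rule ext_rel_eq, rule mult.assoc)
  show "1 * a = a" by (transfer, rule ext_rel_eq, rule mult_1_left)
  show "a * 1 = a" by (transfer, rule ext_rel_eq, rule mult_1_right)
  show "(a + b) * c = a * c + b * c" by (transfer, rule ext_rel_eq, rule distrib_right)
  show "a * (b + c) = a * b + a * c" by (transfer, rule ext_rel_eq, rule distrib_left)
  show "(0::ext) \<noteq> 1"
  proof (transfer, rule notI)
    assume "ext_rel 0 1"
    then have "Poly_Mapping.lookup (0 - 1 :: tensor) 0 = 0"
      unfolding ext_rel_def by (rule ext_ideal_lookup_zero)
    then show False by simp
  qed
qed

end

lift_definition ext_of :: "vdual \<Rightarrow> ext" is tensor_of .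

lift_definition ext_scalar :: "rat \<Rightarrow> ext" is "Poly_Mapping.single 0" .

lemma ext_scalar_0: "ext_scalar 0 = 0"
  by transfer (rule ext_rel_eq, simp)

lemma ext_scalar_1: "ext_scalar 1 = 1"
  by transfer (rule ext_rel_eq, simp)

lemma ext_scalar_add: "ext_scalar (a + b) = ext_scalar a + ext_scalar b"
  by transfer (rule ext_rel_eq, rule single_add)

lemma ext_scalar_mult: "ext_scalar (a * b) = ext_scalar a * ext_scalar b"
  by transfer (rule ext_rel_eq, simp add: mult_single)

lemma ext_scalar_sum: "ext_scalar (sum f A) = (\<Sum>x\<in>A. ext_scalar (f x))"
  by (induction A rule: infinite_finite_induct) (simp_all add: ext_scalar_0 ext_scalar_add)

definition is_partition :: "nat \<Rightarrow> nat list \<Rightarrow> bool" where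
  "is_partition k \<nu> \<longleftrightarrow> length \<nu> = k \<and> sorted_wrt (\<ge>) \<nu>"

definition part :: "nat list \<Rightarrow> nat \<Rightarrow> nat" where
  "part \<nu> i = \<nu> ! (i - 1)"

definition wedge_beta :: "nat \<Rightarrow> nat list \<Rightarrow> ext" where
  "wedge_beta k \<nu> = prod_list (map (\<lambda>i. ext_of (\<beta> (k - i + part \<nu> i))) [1..<Suc k])"


section \<open>Formal power series in \<open>w\<^sub>1\<^sup>-\<^sup>1, w\<^sub>2\<^sup>-\<^sup>1, \<dots>\<close>\<close>

text \<open>
  The coefficient at \<open>m\<close> is that of \<open>\<Prod>\<^sub>i w\<^sub>i\<^sup>-\<^sup>m\<^sup>(\<^sup>i\<^sup>)\<close>. There are countably many variables, of which
  only \<open>w\<^sub>1, \<dots>, w\<^sub>k\<close> will occur.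
\<close>

typedef 'a mfps = "UNIV :: ((nat \<Rightarrow>\<^sub>0 nat) \<Rightarrow> 'a) set"
  morphisms mfps_nth Abs_mfps ..

setup_lifting type_definition_mfps

definition antidiag :: "(nat \<Rightarrow>\<^sub>0 nat) \<Rightarrow> ((nat \<Rightarrow>\<^sub>0 nat) \<times> (nat \<Rightarrow>\<^sub>0 nat)) set" where
  "antidiag m = {(a, b). a + b = m}"

lemma finite_antidiag: "finite (antidiag m)"
proof -
  let ?K = "Poly_Mapping.keys m"
  let ?B = "{..Max (insert 0 (Poly_Mapping.lookup m ` ?K))}"
  let ?F = "{f. \<forall>i. (i \<in> ?K \<longrightarrow> f i \<in> ?B) \<and> (i \<notin> ?K \<longrightarrow> f i = (0::nat))}"
  have "finite ?F"
    by (rule finite_set_of_finite_funs) auto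
  have "Poly_Mapping.lookup a \<in> ?F" if "a + b = m" for a b
  proof -
    have le: "Poly_Mapping.lookup a i \<le> Poly_Mapping.lookup m i" for i
      using that by (auto simp: lookup_add)
    have "Poly_Mapping.lookup a i \<in> ?B" if "i \<in> ?K" for i
    proof -
      have "Poly_Mapping.lookup m i \<le> Max (insert 0 (Poly_Mapping.lookup m ` ?K))"
        by (rule Max_ge) (use that in simp_all)
      with le[of i] show ?thesis by (simp only: atMost_iff)
    qed
    moreover have "Poly_Mapping.lookup a i = 0" if "i \<notin> ?K" for i
      using le[of i] that by (simp add: in_keys_iff)
    ultimately show ?thesis by blast
  qed
  then have sub: "Poly_Mapping.lookup ` fst ` antidiag m \<subseteq> ?F"
    by (intro subsetI) (elim imageE; simp only: antidiag_def mem_Collect_eq case_prod_beta)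
  have "inj_on Poly_Mapping.lookup (fst ` antidiag m)"
    by (rule inj_onI) (simp add: poly_mapping_eqI)
  with finite_subset[OF sub \<open>finite ?F\<close>] have "finite (fst ` antidiag m)"
    by (rule finite_imageD)
  moreover have "inj_on fst (antidiag m)"
    by (auto simp: inj_on_def antidiag_def)
  ultimately show ?thesis
    by (rule finite_imageD)
qed

lemma antidiag_assoc_sum:
  fixes g :: "_ \<Rightarrow> _ \<Rightarrow> _ \<Rightarrow> 'a::comm_monoid_add"
  shows "(\<Sum>(a, b)\<in>antidiag m. \<Sum>(c, d)\<in>antidiag a. g c d b) =
         (\<Sum>(c, e)\<in>antidiag m. \<Sum>(d, b)\<in>antidiag e. g c d b)"
  unfolding case_prod_beta sum.Sigma[OF finite_antidiag ballI[OF finite_antidiag]]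
  by (rule sum.reindex_bij_witness[where
        i = "\<lambda>x. ((fst (fst x) + fst (snd x), snd (snd x)), (fst (fst x), fst (snd x)))" and
        j = "\<lambda>x. ((fst (snd x), snd (snd x) + snd (fst x)), (snd (snd x), snd (fst x)))"])
     (auto simp: antidiag_def add.assoc)

lemma antidiag_zero_left:
  fixes g :: "_ \<Rightarrow> 'a::comm_monoid_add"
  shows "(\<Sum>(a, b)\<in>antidiag m. if a = 0 then g b else 0) = g m"
proof -
  have "(\<Sum>(a, b)\<in>antidiag m. if a = 0 then g b else 0) =
        (\<Sum>x\<in>antidiag m. if x = (0, m) then g m else 0)"
    by (rule sum.cong) (auto simp: antidiag_def split: if_splits)
  also have "\<dots> = g m"
    by (simp add: sum.delta[OF finite_antidiag]) (simp add: antidiag_def)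
  finally show ?thesis .
qed

lemma antidiag_zero_right:
  fixes g :: "_ \<Rightarrow> 'a::comm_monoid_add"
  shows "(\<Sum>(a, b)\<in>antidiag m. if b = 0 then g a else 0) = g m"
proof -
  have "(\<Sum>(a, b)\<in>antidiag m. if b = 0 then g a else 0) =
        (\<Sum>x\<in>antidiag m. if x = (m, 0) then g m else 0)"
    by (rule sum.cong) (auto simp: antidiag_def split: if_splits)
  also have "\<dots> = g m"
    by (simp add: sum.delta[OF finite_antidiag]) (simp add: antidiag_def)
  finally show ?thesis .
qed

instantiation mfps :: (ring_1) ring_1
begin

lift_definition zero_mfps :: "'a mfps" is "\<lambda>_. 0" .
lift_definition one_mfps :: "'a mfps" is "\<lambda>m. if m = 0 then 1 else 0" .
lift_definition plus_mfps :: "'a mfps \<Rightarrow> 'a mfps \<Rightarrow> 'a mfps" is "\<lambda>F G m. F m + G m" .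
lift_definition minus_mfps :: "'a mfps \<Rightarrow> 'a mfps \<Rightarrow> 'a mfps" is "\<lambda>F G m. F m - G m" .
lift_definition uminus_mfps :: "'a mfps \<Rightarrow> 'a mfps" is "\<lambda>F m. - F m" .
lift_definition times_mfps :: "'a mfps \<Rightarrow> 'a mfps \<Rightarrow> 'a mfps"
  is "\<lambda>F G m. \<Sum>(a, b)\<in>antidiag m. F a * G b" .

instance
proof
  fix F G H :: "'a mfps"
  show "F * G * H = F * (G * H)"
  proof (transfer, rule ext)
    fix F G H :: "(nat \<Rightarrow>\<^sub>0 nat) \<Rightarrow> 'a" and m
    have "(\<Sum>(a, b)\<in>antidiag m. (\<Sum>(c, d)\<in>antidiag a. F c * G d) * H b) =
          (\<Sum>(a, b)\<in>antidiag m. \<Sum>(c, d)\<in>antidiag a. F c * G d * H b)"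
      by (simp add: sum_distrib_right case_prod_beta)
    also have "\<dots> = (\<Sum>(c, e)\<in>antidiag m. \<Sum>(d, b)\<in>antidiag e. F c * G d * H b)"
      by (rule antidiag_assoc_sum)
    also have "\<dots> = (\<Sum>(c, e)\<in>antidiag m. F c * (\<Sum>(d, b)\<in>antidiag e. G d * H b))"
      by (simp add: sum_distrib_left case_prod_beta mult.assoc)
    finally show "(\<Sum>(a, b)\<in>antidiag m. (\<Sum>(c, d)\<in>antidiag a. F c * G d) * H b) =
          (\<Sum>(c, e)\<in>antidiag m. F c * (\<Sum>(d, b)\<in>antidiag e. G d * H b))" .
  qed
  show "1 * F = F"
    by transfer (simp add: if_distrib[of "\<lambda>x. x * _"] antidiag_zero_left cong: if_cong)
  show "F * 1 = F"
    by transfer (simp add: if_distrib[of "\<lambda>x. _ * x"] antidiag_zero_right cong: if_cong)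
  show "(F + G) * H = F * H + G * H"
    by transfer (simp add: distrib_right sum.distrib case_prod_beta)
  show "F * (G + H) = F * G + F * H"
    by transfer (simp add: distrib_left sum.distrib case_prod_beta)
  show "(0 :: 'a mfps) \<noteq> 1"
    by transfer (auto simp: fun_eq_iff)
qed (transfer; simp add: fun_eq_iff algebra_simps)+

end

definition mfps_monom :: "(nat \<Rightarrow>\<^sub>0 nat) \<Rightarrow> 'a::ring_1 \<Rightarrow> 'a mfps" where
  "mfps_monom m c = Abs_mfps (\<lambda>n. if n = m then c else 0)"

text \<open>
  Coefficientwise sum of a family of series; it is meaningful for families that are locally finite,
  in the sense that each monomial occurs in only finitely many of the \<open>F x\<close>.
\<close>

definition formal_sum :: "'x set \<Rightarrow> ('x \<Rightarrow> 'a::ring_1 mfps) \<Rightarrow> 'a mfps" where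
  "formal_sum A F = Abs_mfps (\<lambda>m. \<Sum>x\<in>{x\<in>A. mfps_nth (F x) m \<noteq> 0}. mfps_nth (F x) m)"

definition beta_series :: "nat \<Rightarrow> ext mfps" where
  "beta_series i = formal_sum UNIV (\<lambda>j. mfps_monom (Poly_Mapping.single i j) (ext_of (\<beta> j)))"


section \<open>Polynomials in the \<open>w\<^sub>i\<^sup>-\<^sup>1\<close> and rational functions\<close>

text \<open>
  \<open>X i\<close> is the variable \<open>w\<^sub>i\<^sup>-\<^sup>1\<close>; hence \<open>w i\<close> is its inverse in the field of rational functions.
\<close>

type_synonym mpoly = "(nat \<Rightarrow>\<^sub>0 nat) \<Rightarrow>\<^sub>0 rat"

definition X :: "nat \<Rightarrow> mpoly" where
  "X i = Poly_Mapping.single (Poly_Mapping.single i 1) 1"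

definition w :: "nat \<Rightarrow> mpoly fract" where
  "w i = inverse (Fract (X i) 1)"

definition vandermonde :: "nat \<Rightarrow> (nat \<Rightarrow> 'a::comm_ring_1) \<Rightarrow> 'a" where
  "vandermonde k x = (\<Prod>(i, j)\<in>{(i, j). 1 \<le> i \<and> i < j \<and> j \<le> k}. x j - x i)"

text \<open>
  \<open>\<Delta>\<^sub>0(w) = vandermonde k w\<close>. Passing to the inverse variables reverses each of its factors:
  \<open>(\<Prod>\<^sub>j w\<^sub>j\<^bsup>k-1\<^esup>) / \<Delta>\<^sub>0(w) = (-1)\<^bsup>k(k-1)/2\<^esup> / \<Prod>\<^bsub>i<j\<^esub> (w\<^sub>j\<^sup>-\<^sup>1 - w\<^sub>i\<^sup>-\<^sup>1)\<close>, whence the sign that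
  has to accompany this prefactor in the generating function identity.
\<close>

text \<open>JNF matrices are indexed from 0, hence \<open>r = i - 1\<close> and \<open>c = j - 1\<close> below.\<close>

definition alternant :: "nat \<Rightarrow> nat list \<Rightarrow> (nat \<Rightarrow> 'a::comm_ring_1) \<Rightarrow> 'a" where
  "alternant k \<nu> x =
     det (mat k k (\<lambda>(r, c). let i = Suc r; j = Suc c in x j ^ (part \<nu> (k - i + 1) + i - 1)))"

text \<open>\<open>s\<^sub>\<nu>(w\<^sub>1\<^sup>-\<^sup>1, \<dots>, w\<^sub>k\<^sup>-\<^sup>1)\<close>: the quotient of the two alternating polynomials is taken in the field of
  rational functions, where it is the image of a unique polynomial.\<close>

definition schur :: "nat \<Rightarrow> nat list \<Rightarrow> mpoly" where
  "schur k \<nu> = (THE p. Fract p 1 =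
     alternant k \<nu> (\<lambda>j. Fract (X j) 1) / vandermonde k (\<lambda>j. Fract (X j) 1))"

definition mfps_of_mpoly :: "mpoly \<Rightarrow> ext mfps" where
  "mfps_of_mpoly p = Abs_mfps (\<lambda>m. ext_scalar (Poly_Mapping.lookup p m))"

lemma lookup_mpoly_mult:
  fixes p q :: mpoly
  shows "Poly_Mapping.lookup (p * q) m =
     (\<Sum>(a, b)\<in>antidiag m. Poly_Mapping.lookup p a * Poly_Mapping.lookup q b)"
proof -
  let ?f = "\<lambda>(a, b). Poly_Mapping.lookup p a * Poly_Mapping.lookup q b when m = a + b"
  have "Poly_Mapping.lookup (p * q) m = (\<Sum>x. ?f x)"
    by (simp add: times_poly_mapping.rep_eq prod_fun_unfold_prod)
  also have "\<dots> = (\<Sum>x\<in>antidiag m. ?f x)"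
    by (rule Sum_any.expand_superset[OF finite_antidiag]) (auto simp: antidiag_def)
  also have "\<dots> = (\<Sum>(a, b)\<in>antidiag m. Poly_Mapping.lookup p a * Poly_Mapping.lookup q b)"
    by (rule sum.cong) (auto simp: antidiag_def)
  finally show ?thesis .
qed

lemma mfps_of_mpoly_mult: "mfps_of_mpoly (p * q) = mfps_of_mpoly p * mfps_of_mpoly q"
  by (simp add: mfps_of_mpoly_def times_mfps.abs_eq lookup_mpoly_mult ext_scalar_sum
        ext_scalar_mult case_prod_beta)

lemma mfps_of_mpoly_act:
  "mfps_of_mpoly p * (mfps_of_mpoly q * F) = mfps_of_mpoly (p * q) * F"
  by (simp add: mfps_of_mpoly_mult mult.assoc)

lemma mfps_of_mpoly_1: "mfps_of_mpoly 1 = 1"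
  by (rule mfps_nth_inject[THEN iffD1])
     (auto simp: mfps_of_mpoly_def one_mfps.rep_eq Abs_mfps_inverse lookup_one fun_eq_iff
        ext_scalar_0 ext_scalar_1 when_def)


section \<open>Fractions of formal series\<close>

text \<open>
  The localisation of the \<open>\<rat>[w\<^sub>1\<^sup>-\<^sup>1, w\<^sub>2\<^sup>-\<^sup>1, \<dots>]\<close>-module \<open>(\<And>V\<^sup>*)[[w\<^sub>1\<^sup>-\<^sup>1, w\<^sub>2\<^sup>-\<^sup>1, \<dots>]]\<close> at the nonzero
  polynomials, i.e. its base change to the field of rational functions: \<open>(F, d)\<close> stands for \<open>F/d\<close>.
\<close>

definition frac_rel :: "ext mfps \<times> mpoly \<Rightarrow> ext mfps \<times> mpoly \<Rightarrow> bool" where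
  "frac_rel = (\<lambda>(F, d) (G, e). d \<noteq> 0 \<and> e \<noteq> 0 \<and>
     (\<exists>u. u \<noteq> 0 \<and> mfps_of_mpoly (u * e) * F = mfps_of_mpoly (u * d) * G))"

lemma frac_rel_self: "frac_rel (F, d) (F, d) \<longleftrightarrow> d \<noteq> 0"
proof -
  have "\<exists>u :: mpoly. u \<noteq> 0"
    by (rule exI[of _ 1]) simp
  then show ?thesis
    by (simp add: frac_rel_def)
qed

lemma frac_rel_trans:
  assumes "frac_rel (F, d) (G, e)" and "frac_rel (G, e) (H, f)"
  shows "frac_rel (F, d) (H, f)"
proof -
  from assms obtain u v where nz: "d \<noteq> 0" "e \<noteq> 0" "f \<noteq> 0" "u \<noteq> 0" "v \<noteq> 0"
    and u: "mfps_of_mpoly (u * e) * F = mfps_of_mpoly (u * d) * G"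
    and v: "mfps_of_mpoly (v * f) * G = mfps_of_mpoly (v * e) * H"
    by (auto simp: frac_rel_def)
  have *: "mfps_of_mpoly ((u * v * e) * f) * F = mfps_of_mpoly ((u * v * e) * d) * H"
  proof -
    have "mfps_of_mpoly ((u * v * e) * f) * F = mfps_of_mpoly ((v * f) * (u * e)) * F"
      by (simp only: ac_simps)
    also have "\<dots> = mfps_of_mpoly (v * f) * (mfps_of_mpoly (u * d) * G)"
      by (simp only: mfps_of_mpoly_act[of "v * f" "u * e", symmetric] u)
    also have "\<dots> = mfps_of_mpoly ((u * d) * (v * f)) * G"
      unfolding mfps_of_mpoly_act by (simp only: mult.commute)
    also have "\<dots> = mfps_of_mpoly (u * d) * (mfps_of_mpoly (v * e) * H)"
      by (simp only: mfps_of_mpoly_act[of "u * d" "v * f", symmetric] v)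
    also have "\<dots> = mfps_of_mpoly ((u * v * e) * d) * H"
      unfolding mfps_of_mpoly_act by (simp only: ac_simps)
    finally show ?thesis .
  qed
  have "u * v * e \<noteq> 0"
    using nz by simp
  with nz * show ?thesis
    unfolding frac_rel_def prod.case by blast
qed

quotient_type frac_series = "ext mfps \<times> mpoly" / partial: frac_rel
proof (rule part_equivpI)
  show "\<exists>x. frac_rel x x"
    by (rule exI[of _ "(0, 1)"]) (simp add: frac_rel_self)
  show "symp frac_rel"
    by (rule sympI) (auto simp: frac_rel_def intro: sym)
  show "transp frac_rel"
    by (rule transpI) (metis frac_rel_trans surj_pair)
qed

definition frac_series_of :: "ext mfps \<Rightarrow> frac_series" where
  "frac_series_of F = abs_frac_series (F, 1)"

lemma frac_rel_scale:
  assumes "fractrel (a, b) (a', b')" and "frac_rel (F, d) (F', d')"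
  shows "frac_rel (mfps_of_mpoly a * F, b * d) (mfps_of_mpoly a' * F', b' * d')"
proof -
  from assms obtain u where nz: "b \<noteq> 0" "b' \<noteq> 0" "d \<noteq> 0" "d' \<noteq> 0" "u \<noteq> 0"
    and ab: "a * b' = a' * b"
    and u: "mfps_of_mpoly (u * d') * F = mfps_of_mpoly (u * d) * F'"
    by (auto simp: frac_rel_def)
  have *: "mfps_of_mpoly (u * (b' * d')) * (mfps_of_mpoly a * F) =
      mfps_of_mpoly (u * (b * d)) * (mfps_of_mpoly a' * F')"
  proof -
    have "mfps_of_mpoly (u * (b' * d')) * (mfps_of_mpoly a * F) =
          mfps_of_mpoly ((a * b') * (u * d')) * F"
      unfolding mfps_of_mpoly_act by (simp only: ac_simps)
    also have "\<dots> = mfps_of_mpoly (a' * b) * (mfps_of_mpoly (u * d) * F')"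
      by (simp only: ab mfps_of_mpoly_act[of "a' * b" "u * d'", symmetric] u)
    also have "\<dots> = mfps_of_mpoly (u * (b * d)) * (mfps_of_mpoly a' * F')"
      unfolding mfps_of_mpoly_act by (simp only: ac_simps)
    finally show ?thesis .
  qed
  show ?thesis
    unfolding frac_rel_def prod.case using nz * by (intro conjI exI[of _ u]) simp_all
qed

definition frac_scale :: "mpoly fract \<Rightarrow> frac_series \<Rightarrow> frac_series" where
  "frac_scale q y = (case (rep_fract q, rep_frac_series y) of
     ((a, b), (F, d)) \<Rightarrow> abs_frac_series (mfps_of_mpoly a * F, b * d))"

lemma frac_scale_Fract:
  assumes "b \<noteq> 0" and "d \<noteq> 0"
  shows "frac_scale (Fract a b) (abs_frac_series (F, d)) =
           abs_frac_series (mfps_of_mpoly a * F, b * d)"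
proof -
  obtain a' b' where q: "rep_fract (Fract a b) = (a', b')" by (metis surj_pair)
  obtain F' d' where y: "rep_frac_series (abs_frac_series (F, d)) = (F', d')" by (metis surj_pair)
  have "Fract a b = abs_fract (a, b)"
    using assms by (simp add: Fract.abs_eq)
  then have "fractrel (a', b') (a, b)"
    using assms q rep_abs_rsp_left[OF Quotient3_fract, of "(a, b)" "(a, b)"] by simp
  moreover have "frac_rel (F', d') (F, d)"
    using assms y rep_abs_rsp_left[OF Quotient3_frac_series, of "(F, d)" "(F, d)"]
    by (simp add: frac_rel_self)
  ultimately have "frac_rel (mfps_of_mpoly a' * F', b' * d') (mfps_of_mpoly a * F, b * d)"
    by (rule frac_rel_scale)
  then have "abs_frac_series (mfps_of_mpoly a' * F', b' * d') =
             abs_frac_series (mfps_of_mpoly a * F, b * d)"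
    by (rule Quotient3_rel_abs[OF Quotient3_frac_series])
  then show ?thesis
    by (simp add: frac_scale_def q y)
qed

lemma frac_series_of_eq_scale_iff:
  assumes "b \<noteq> 0"
  shows "frac_series_of F = frac_scale (Fract a b) (frac_series_of G) \<longleftrightarrow>
    (\<exists>u. u \<noteq> 0 \<and> mfps_of_mpoly (u * b) * F = mfps_of_mpoly (u * a) * G)"
proof -
  have "frac_series_of F = frac_scale (Fract a b) (frac_series_of G) \<longleftrightarrow>
        frac_rel (F, 1) (mfps_of_mpoly a * G, b)"
    using assms Quotient3_rel[OF Quotient3_frac_series, of "(F, 1)" "(mfps_of_mpoly a * G, b)"]
    by (simp add: frac_series_of_def frac_scale_Fract frac_rel_self)
  also have "\<dots> \<longleftrightarrow> (\<exists>u. u \<noteq> 0 \<and> mfps_of_mpoly (u * b) * F = mfps_of_mpoly (u * a) * G)"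
    using assms by (simp add: frac_rel_def mfps_of_mpoly_mult mfps_of_mpoly_1 mult.assoc)
  finally show ?thesis .
qed

end

theory Submission
  imports Defs
begin

text \<open>
  The prefactor equals \<open>1 / \<Prod>\<^bsub>i<j\<^esub> (w\<^sub>j\<^sup>-\<^sup>1 - w\<^sub>i\<^sup>-\<^sup>1)\<close>, so after clearing it the claim is that the alternants
  in the \<open>w\<^sub>i\<^sup>-\<^sup>1\<close> generate the wedges \<open>[\<beta>]\<^sub>\<nu>\<close>. A coefficient of \<open>\<beta>(w\<^sub>k\<^sup>-\<^sup>1) \<and> \<dots> \<and> \<beta>(w\<^sub>1\<^sup>-\<^sup>1)\<close> is a wedge of
  basis vectors, which vanishes if two indices agree and is otherwise put into decreasing order by a
  unique permutation; this produces exactly one term of the Leibniz expansion of one alternant.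
  Newton interpolation of \<open>t\<^sup>a\<close> at the nodes \<open>w\<^sub>i\<^sup>-\<^sup>1\<close> factors the matrix of the alternant into a matrix of
  divided differences and a triangular matrix whose determinant is the Vandermonde product. Hence the
  Schur polynomial is a determinant of divided differences, and the degrees of these bound
  \<open>\<nu>\<^sub>1\<close> by the degree of each monomial of \<open>s\<^sub>\<nu>\<close>, so that the sum over \<open>\<nu>\<close> is locally finite.
\<close>

section \<open>Alternants and divided differences\<close>

lemma vandermonde_0: "vandermonde 0 x = 1"
  unfolding vandermonde_def by (rule prod.neutral) auto

lemma vandermonde_Suc:
  "vandermonde (Suc k) x = vandermonde k x * (\<Prod>s<k. x (Suc k) - x (Suc s))"
proof -
  let ?A = "\<lambda>k. {(i, j). 1 \<le> i \<and> i < j \<and> j \<le> (k::nat)}"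
  have fin: "finite (?A k)"
    by (rule finite_subset[of _ "{..k} \<times> {..k}"]) auto
  have split: "?A (Suc k) = ?A k \<union> {1..k} \<times> {Suc k}"
    by (rule Set.set_eqI) (auto simp: le_Suc_eq)
  have "vandermonde (Suc k) x = vandermonde k x * (\<Prod>(i, j)\<in>{1..k} \<times> {Suc k}. x j - x i)"
    unfolding vandermonde_def split by (rule prod.union_disjoint[OF fin]) auto
  also have "(\<Prod>(i, j)\<in>{1..k} \<times> {Suc k}. x j - x i) = (\<Prod>s<k. x (Suc k) - x (Suc s))"
    by (rule prod.reindex_bij_witness[of _ "\<lambda>s. (Suc s, Suc k)" "\<lambda>(i, j). i - 1"]) auto
  finally show ?thesis .
qed

lemma vandermonde_eq_prod: "vandermonde k x = (\<Prod>c<k. \<Prod>s<c. x (Suc c) - x (Suc s))"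
  by (induction k) (simp_all add: vandermonde_0 vandermonde_Suc)

text \<open>Each factor obeys 1/b - 1/a = -(b - a)/(ab). Every variable lies in \<open>k - 1\<close>
  of the \<open>k * (k - 1) div 2\<close> pairs, whence the powers and the sign.\<close>

lemma vandermonde_inverse:
  fixes y :: "nat \<Rightarrow> 'a::field"
  assumes "\<And>i. y i \<noteq> 0"
  shows "vandermonde k (\<lambda>i. inverse (y i)) * (\<Prod>j=1..k. y j ^ (k - 1)) =
    (- 1) ^ (k * (k - 1) div 2) * vandermonde k y"
proof (induction k)
  case (Suc k)
  let ?P = "\<lambda>n. \<Prod>j=1..k. y j ^ n"
  \<comment> \<open>Raising the old exponents from \<open>k - 1\<close> to \<open>k\<close> supplies
    the denominators \<open>y (Suc s)\<close> of the new factors. For \<open>k = 0\<close> the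
    product is empty, so the truncated \<open>k - 1\<close> is harmless.\<close>
  have pw: "?P k = ?P (k - 1) * (\<Prod>s<k. y (Suc s))"
  proof -
    have "(\<Prod>s<k. y (Suc s)) = (\<Prod>j=1..k. y j)"
      by (rule prod.reindex_bij_witness[of _ "\<lambda>j. j - 1" Suc]) auto
    moreover have "?P k = (\<Prod>j=1..k. y j ^ (k - 1) * y j)"
      by (rule prod.cong) (auto simp flip: power_Suc2)
    ultimately show ?thesis by (simp add: prod.distrib)
  qed
  have factor: "(\<Prod>s<k. inverse (y (Suc k)) - inverse (y (Suc s))) * (\<Prod>s<k. y (Suc s)) * y (Suc k) ^ k
      = (- 1) ^ k * (\<Prod>s<k. y (Suc k) - y (Suc s))"
  proof -
    have "(\<Prod>s<k. inverse (y (Suc k)) - inverse (y (Suc s))) * (\<Prod>s<k. y (Suc s)) * y (Suc k) ^ k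
        = (\<Prod>s<k. (inverse (y (Suc k)) - inverse (y (Suc s))) * y (Suc s) * y (Suc k))"
      by (simp add: prod.distrib)
    also have "\<dots> = (\<Prod>s<k. (- 1) * (y (Suc k) - y (Suc s)))"
      by (rule prod.cong) (use assms in \<open>auto simp: field_simps\<close>)
    finally show ?thesis by (simp only: prod.distrib prod_constant card_lessThan)
  qed
  have sgn: "Suc k * (Suc k - 1) div 2 = k * (k - 1) div 2 + k"
    by (cases k) simp_all
  have "vandermonde (Suc k) (\<lambda>i. inverse (y i)) * (\<Prod>j=1..Suc k. y j ^ (Suc k - 1)) =
      (vandermonde k (\<lambda>i. inverse (y i)) * ?P (k - 1)) *
      ((\<Prod>s<k. inverse (y (Suc k)) - inverse (y (Suc s))) * (\<Prod>s<k. y (Suc s)) * y (Suc k) ^ k)"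
    by (simp only: vandermonde_Suc diff_Suc_1 prod.nat_ivl_Suc'[of 1 k] pw mult_ac)
  also have "\<dots> = (- 1) ^ (k * (k - 1) div 2 + k) * vandermonde (Suc k) y"
    unfolding Suc.IH factor by (simp add: vandermonde_Suc power_add mult_ac)
  finally show ?case unfolding sgn .
qed (simp add: vandermonde_0)

text \<open>\<open>power_dd A a\<close> is the divided difference of \<open>t \<mapsto> t ^ a\<close> at the nodes \<open>A\<close>, which is the complete
  homogeneous polynomial of degree \<open>a + 1 - length A\<close> in \<open>A\<close>. The last equation is the Leibniz rule
  for \<open>t * t ^ a\<close>.\<close>

fun power_dd :: "'a::comm_ring_1 list \<Rightarrow> nat \<Rightarrow> 'a" where
  "power_dd [] a = 0"
| "power_dd (z # A) 0 = (if A = [] then 1 else 0)"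
| "power_dd (z # A) (Suc a) = z * power_dd (z # A) a + power_dd A a"

lemma power_dd_single: "power_dd [z] a = z ^ a"
  by (induction a) simp_all

text \<open>The divided-difference recurrence with its denominator cleared, hence valid for
  coincident nodes and over any commutative ring.\<close>

lemma power_dd_diff: "(y - z) * power_dd (y # z # A) a = power_dd (y # A) a - power_dd (z # A) a"
proof (induction a)
  case (Suc a)
  have "(y - z) * power_dd (y # z # A) (Suc a) =
      y * ((y - z) * power_dd (y # z # A) a) + (y - z) * power_dd (z # A) a"
    by (simp add: algebra_simps)
  also have "\<dots> = power_dd (y # A) (Suc a) - power_dd (z # A) (Suc a)"
    unfolding Suc.IH by (simp add: algebra_simps)
  finally show ?case .
qed simp

text \<open>Newton's formula with exact remainder. The nodes are listed in reverse so that the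
  newest one stands at the head, where \<open>power_dd_diff\<close> acts.\<close>

lemma newton_interpolation_power:
  "y ^ a = (\<Sum>r<n. power_dd (map x (rev [0..<Suc r])) a * (\<Prod>s<r. y - x s)) +
     power_dd (y # map x (rev [0..<n])) a * (\<Prod>s<n. y - x s)"
proof (induction n)
  case (Suc n)
  \<comment> \<open>The old remainder splits into the next Newton coefficient and the new
    remainder.\<close>
  have eq: "power_dd (y # map x (rev [0..<n])) a =
      power_dd (map x (rev [0..<Suc n])) a +
      (y - x n) * power_dd (y # map x (rev [0..<Suc n])) a"
    using power_dd_diff[of y "x n" "map x (rev [0..<n])" a] by simp
  show ?case
    by (simp only: Suc.IH eq sum.lessThan_Suc prod.lessThan_Suc) (simp only: algebra_simps)
qed (simp add: power_dd_single)

text \<open>A flagged Jacobi-Trudi determinant: the entry at \<open>(r, c)\<close> is the complete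
  homogeneous polynomial of degree \<open>part \<nu> (k - r) + r - c\<close> in the first
  \<open>c + 1\<close> variables, or zero if \<open>c\<close> exceeds
  \<open>part \<nu> (k - r) + r\<close>.\<close>

definition schur_dd :: "nat \<Rightarrow> nat list \<Rightarrow> (nat \<Rightarrow> 'a::comm_ring_1) \<Rightarrow> 'a" where
  "schur_dd k \<nu> x = det (mat k k (\<lambda>(r, c).
     power_dd (map (\<lambda>s. x (Suc s)) (rev [0..<Suc c])) (part \<nu> (k - r) + r)))"

lemma alternant_altdef:
  "alternant k \<nu> x = det (mat k k (\<lambda>(r, c). x (Suc c) ^ (part \<nu> (k - r) + r)))"
  unfolding alternant_def
  by (rule arg_cong[where f = det]) (auto simp: Suc_diff_Suc)

text \<open>\<open>?H\<close> holds the Newton coefficients of the powers, \<open>?N\<close> the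
  values of the Newton basis polynomials at the nodes.\<close>

lemma alternant_eq_schur_dd: "alternant k \<nu> x = schur_dd k \<nu> x * vandermonde k x"
proof -
  let ?x = "\<lambda>s. x (Suc s)"
  let ?H = "mat k k (\<lambda>(r, c). power_dd (map ?x (rev [0..<Suc c])) (part \<nu> (k - r) + r))"
  let ?N = "mat k k (\<lambda>(r, c). \<Prod>s<r. ?x c - ?x s)"
  have "mat k k (\<lambda>(r, c). ?x c ^ (part \<nu> (k - r) + r)) = ?H * ?N"
  proof (rule eq_matI)
    fix i j assume "i < dim_row (?H * ?N)" "j < dim_col (?H * ?N)"
    then have ij: "i < k" "j < k" by simp_all
    let ?a = "part \<nu> (k - i) + i"
    \<comment> \<open>The Newton remainder vanishes because the evaluation point \<open>?x j\<close>
      is one of the \<open>k\<close> nodes.\<close>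
    have "(\<Prod>s<k. ?x j - ?x s) = 0"
      using ij by (intro prod_zero) auto
    then have "?x j ^ ?a =
        (\<Sum>r<k. power_dd (map ?x (rev [0..<Suc r])) ?a * (\<Prod>s<r. ?x j - ?x s))"
      using newton_interpolation_power[of "?x j" ?a ?x k] by simp
    then show "mat k k (\<lambda>(r, c). ?x c ^ (part \<nu> (k - r) + r)) $$ (i, j) = (?H * ?N) $$ (i, j)"
      using ij by (simp add: scalar_prod_def atLeast0LessThan)
  qed simp_all
  moreover have "det ?N = vandermonde k x"
  proof -
    \<comment> \<open>Below the diagonal, the factor \<open>s = j\<close> is zero.\<close>
    have "?N $$ (i, j) = 0" if "j < i" "i < k" for i j
      using that by (auto intro!: prod_zero)
    then have "det ?N = prod_list (diag_mat ?N)"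
      by (intro det_upper_triangular) auto
    also have "\<dots> = vandermonde k x"
      by (simp add: vandermonde_eq_prod prod_list_diag_prod atLeast0LessThan)
    finally show ?thesis .
  qed
  ultimately show ?thesis
    by (simp add: alternant_altdef schur_dd_def det_mult[of _ k])
qed

section \<open>Passage to the field of rational functions\<close>

lemma X_eq_iff: "X i = X j \<longleftrightarrow> i = j"
proof
  assume "X i = X j"
  then have "Poly_Mapping.lookup (X i) (Poly_Mapping.single i 1) =
      Poly_Mapping.lookup (X j) (Poly_Mapping.single i 1)" by simp
  then have "Poly_Mapping.single j (1::nat) = Poly_Mapping.single i 1"
    by (simp add: X_def lookup_single when_def split: if_splits)
  then have "Poly_Mapping.lookup (Poly_Mapping.single j (1::nat)) i = 1" by simp
  then show "i = j" by (simp add: lookup_single when_def split: if_splits)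
qed simp

lemma X_nonzero: "X i \<noteq> 0"
proof
  assume "X i = 0"
  then have "Poly_Mapping.lookup (X i) (Poly_Mapping.single i 1) = 0" by simp
  then show False by (simp add: X_def)
qed

lemma vandermonde_X_nonzero: "vandermonde k X \<noteq> 0"
  unfolding vandermonde_eq_prod by (auto simp: X_eq_iff)

lemma comm_ring_hom_Fract: "comm_ring_hom (\<lambda>p::'a::idom. Fract p 1)"
  by standard (auto simp: Zero_fract_def One_fract_def)

lemma vandermonde_hom:
  assumes "comm_ring_hom h"
  shows "vandermonde k (\<lambda>i. h (x i)) = h (vandermonde k x)"
proof -
  interpret comm_ring_hom h by fact
  show ?thesis by (simp add: vandermonde_eq_prod hom_prod hom_minus)
qed

lemma alternant_hom:
  assumes "comm_ring_hom h"
  shows "alternant k \<nu> (\<lambda>i. h (x i)) = h (alternant k \<nu> x)"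
proof -
  interpret comm_ring_hom h by fact
  show ?thesis unfolding alternant_altdef hom_det[symmetric]
    by (rule arg_cong[where f = det]) (auto simp: hom_power)
qed

text \<open>The Vandermonde product cancels in the fraction field, and injectivity of
  \<open>p \<mapsto> Fract p 1\<close> gives the uniqueness that the description in
  \<open>schur\<close> requires.\<close>

lemma schur_eq_schur_dd: "schur k \<nu> = schur_dd k \<nu> X"
proof -
  have "alternant k \<nu> (\<lambda>j. Fract (X j) 1) / vandermonde k (\<lambda>j. Fract (X j) 1) =
      Fract (schur_dd k \<nu> X) 1"
    using vandermonde_X_nonzero[of k]
    by (simp add: alternant_hom[OF comm_ring_hom_Fract] vandermonde_hom[OF comm_ring_hom_Fract]
        alternant_eq_schur_dd eq_fract)
  then show ?thesis
    unfolding schur_def by (simp add: eq_fract)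
qed

text \<open>The sign cancels the one produced by \<open>vandermonde_inverse\<close> at
  \<open>y i = Fract (X i) 1\<close>, and so do the powers of the variables.\<close>

lemma vandermonde_prefactor:
  "(- 1) ^ (k * (k - 1) div 2) * ((\<Prod>j = 1..k. w j ^ (k - 1)) / vandermonde k w) =
     Fract 1 (vandermonde k X)"
proof -
  let ?y = "\<lambda>i. Fract (X i) 1" and ?s = "(- 1) ^ (k * (k - 1) div 2) :: mpoly fract"
  have y: "?y i \<noteq> 0" for i
    by (simp add: X_nonzero Zero_fract_def eq_fract)
  have w: "w = (\<lambda>i. inverse (?y i))"
    by (simp add: fun_eq_iff w_def)
  let ?P = "\<Prod>j=1..k. ?y j ^ (k - 1)"
  have P: "?P \<noteq> 0"
    using y by simp
  have V: "vandermonde k ?y \<noteq> 0"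
    unfolding vandermonde_hom[OF comm_ring_hom_Fract]
    using vandermonde_X_nonzero[of k] by (simp add: Zero_fract_def eq_fract)
  have "vandermonde k w * ?P = ?s * vandermonde k ?y"
    unfolding w by (rule vandermonde_inverse) (rule y)
  then have "vandermonde k w = ?s * vandermonde k ?y / ?P"
    using P by (metis nonzero_mult_div_cancel_right)
  moreover have "(\<Prod>j = 1..k. w j ^ (k - 1)) = inverse ?P"
    by (simp only: w power_inverse prod_inversef[symmetric] comp_def)
  ultimately have "?s * ((\<Prod>j = 1..k. w j ^ (k - 1)) / vandermonde k w) = inverse (vandermonde k ?y)"
    using P V by (simp only: divide_divide_eq_right) (simp add: field_simps)
  then show ?thesis
    using vandermonde_X_nonzero[of k] by (simp add: vandermonde_hom[OF comm_ring_hom_Fract])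
qed

section \<open>Orders of vanishing\<close>

definition mdeg :: "(nat \<Rightarrow>\<^sub>0 nat) \<Rightarrow> nat" where
  "mdeg m = (\<Sum>i\<in>Poly_Mapping.keys m. Poly_Mapping.lookup m i)"

lemma mdeg_superset:
  "finite A \<Longrightarrow> Poly_Mapping.keys m \<subseteq> A \<Longrightarrow> mdeg m = (\<Sum>i\<in>A. Poly_Mapping.lookup m i)"
  unfolding mdeg_def by (rule sum.mono_neutral_left) (auto simp: in_keys_iff)

lemma mdeg_add: "mdeg (a + b) = mdeg a + mdeg b"
proof -
  let ?A = "Poly_Mapping.keys a \<union> Poly_Mapping.keys b"
  have "Poly_Mapping.keys (a + b) \<subseteq> ?A" by (rule Poly_Mapping.keys_add)
  then show ?thesis
    by (simp add: mdeg_superset[of ?A] lookup_add sum.distrib)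
qed

text \<open>Bounds the order of vanishing at the origin from below; for the zero polynomial that
  order is infinite.\<close>

definition order_ge :: "nat \<Rightarrow> mpoly \<Rightarrow> bool" where
  "order_ge d p \<longleftrightarrow> (\<forall>m\<in>Poly_Mapping.keys p. d \<le> mdeg m)"

lemma order_ge_0 [simp]: "order_ge 0 p"
  by (simp add: order_ge_def)

lemma order_ge_zero [simp]: "order_ge d 0"
  by (simp add: order_ge_def)

lemma order_ge_mono: "order_ge d p \<Longrightarrow> e \<le> d \<Longrightarrow> order_ge e p"
  by (auto simp: order_ge_def)

lemma order_ge_add: "order_ge d p \<Longrightarrow> order_ge d q \<Longrightarrow> order_ge d (p + q)"
  using Poly_Mapping.keys_add[of p q] by (auto simp: order_ge_def)

lemma order_ge_sum: "(\<And>x. x \<in> A \<Longrightarrow> order_ge d (f x)) \<Longrightarrow> order_ge d (sum f A)"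
  by (induction A rule: infinite_finite_induct) (auto intro: order_ge_add)

lemma order_ge_mult: "order_ge d p \<Longrightarrow> order_ge e q \<Longrightarrow> order_ge (d + e) (p * q)"
  using keys_mult[of p q] by (fastforce simp: order_ge_def mdeg_add intro: add_mono)

lemma order_ge_X: "order_ge 1 (X i)"
  by (simp add: order_ge_def X_def mdeg_def)

text \<open>Each summand of the recursion pays for the larger exponent, either by a factor of order
  at least one or by one node fewer. With more than \<open>a + 1\<close> nodes the truncated bound
  is zero.\<close>

lemma order_ge_power_dd:
  assumes "\<And>z. z \<in> set A \<Longrightarrow> order_ge 1 z"
  shows "order_ge (Suc a - length A) (power_dd A a)"
  using assms
proof (induction A a rule: power_dd.induct)
  case (3 z A a)
  have "order_ge (1 + (Suc a - length (z # A))) (z * power_dd (z # A) a)"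
    using 3 by (intro order_ge_mult) auto
  then have "order_ge (Suc (Suc a) - length (z # A)) (z * power_dd (z # A) a)"
    by (rule order_ge_mono) simp
  moreover have "order_ge (Suc (Suc a) - length (z # A)) (power_dd A a)"
    using 3 by simp
  ultimately show ?case by (simp add: order_ge_add)
qed simp_all

text \<open>Every Leibniz term contains an entry of the last row, which has exponent
  \<open>part \<nu> 1 + (k - 1)\<close> and at most \<open>k\<close> nodes.\<close>

lemma order_ge_schur:
  assumes "k \<ge> 1"
  shows "order_ge (part \<nu> 1) (schur k \<nu>)"
proof -
  let ?H = "\<lambda>r c. power_dd (map (\<lambda>s. X (Suc s)) (rev [0..<Suc c])) (part \<nu> (k - r) + r)"
  have "order_ge (part \<nu> 1) (signof p * (\<Prod>r = 0..<k. ?H r (p r)))" if "p permutes {0..<k}" for p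
  proof -
    have pk: "p (k - 1) < k"
      using permutes_in_image[OF that, of "k - 1"] assms by simp
    have "order_ge (Suc (part \<nu> 1 + (k - 1)) - Suc (p (k - 1))) (?H (k - 1) (p (k - 1)))"
      using order_ge_power_dd[of "map (\<lambda>s. X (Suc s)) (rev [0..<Suc (p (k - 1))])"
          "part \<nu> (k - (k - 1)) + (k - 1)"] assms order_ge_X by (auto simp del: upt_Suc)
    then have "order_ge (part \<nu> 1) (?H (k - 1) (p (k - 1)))"
      by (rule order_ge_mono) (use pk in linarith)
    then have "order_ge (part \<nu> 1 + 0)
        (?H (k - 1) (p (k - 1)) * (\<Prod>r\<in>{0..<k} - {k - 1}. ?H r (p r)))"
      by (rule order_ge_mult) simp
    also have "?H (k - 1) (p (k - 1)) * (\<Prod>r\<in>{0..<k} - {k - 1}. ?H r (p r)) =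
        (\<Prod>r = 0..<k. ?H r (p r))"
      by (rule prod.remove[symmetric]) (use assms in auto)
    finally have "order_ge (0 + part \<nu> 1) (signof p * (\<Prod>r = 0..<k. ?H r (p r)))"
      by (intro order_ge_mult) simp_all
    then show ?thesis by simp
  qed
  then show ?thesis
    unfolding schur_eq_schur_dd schur_dd_def
    by (subst det_def'[of _ k]) (auto intro!: order_ge_sum simp: permutes_def simp del: upt_Suc)
qed

section \<open>Antisymmetry of the wedge product\<close>

lemma tensor_of_superset:
  "finite A \<Longrightarrow> Poly_Mapping.keys v \<subseteq> A \<Longrightarrow>
     tensor_of v = (\<Sum>j\<in>A. Poly_Mapping.single (Word [j]) (Poly_Mapping.lookup v j))"
  unfolding tensor_of_def by (rule sum.mono_neutral_left) (auto simp: in_keys_iff)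

lemma tensor_of_add: "tensor_of (u + v) = tensor_of u + tensor_of v"
proof -
  let ?A = "Poly_Mapping.keys u \<union> Poly_Mapping.keys v"
  have "Poly_Mapping.keys (u + v) \<subseteq> ?A" by (rule Poly_Mapping.keys_add)
  then show ?thesis
    by (simp add: tensor_of_superset[of ?A] lookup_add single_add sum.distrib)
qed

lemma ext_of_add: "ext_of (u + v) = ext_of u + ext_of v"
  by transfer (rule ext_rel_eq, rule tensor_of_add)

lemma ext_of_square: "ext_of v * ext_of v = 0"
proof (transfer, unfold ext_rel_def)
  fix v
  show "tensor_of v * tensor_of v - 0 \<in> ext_ideal"
    using ext_ideal.step[OF ext_ideal.zero, of 1 v 1] by simp
qed

text \<open>Polarisation of the vanishing square.\<close>

lemma ext_of_anticommute: "ext_of u * ext_of v = - (ext_of v * ext_of u)"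
  using ext_of_square[of "u + v"]
  by (simp add: ext_of_add distrib_left distrib_right ext_of_square eq_neg_iff_add_eq_0 add.commute)

text \<open>Anticommuting the left \<open>u\<close> past the intermediate factors brings it next to
  the right one.\<close>

lemma ext_of_wedge_repeat: "ext_of u * (prod_list (map ext_of vs) * ext_of u) = 0"
proof (induction vs)
  case (Cons v vs)
  have "ext_of u * (prod_list (map ext_of (v # vs)) * ext_of u) =
      (ext_of u * ext_of v) * (prod_list (map ext_of vs) * ext_of u)"
    by (simp add: mult.assoc)
  also have "\<dots> = - (ext_of v * (ext_of u * (prod_list (map ext_of vs) * ext_of u)))"
    by (subst ext_of_anticommute) (simp add: mult.assoc)
  finally show ?case using Cons.IH by simp
qed (simp add: ext_of_square)

text \<open>Polarisation again, now of \<open>ext_of_wedge_repeat\<close>.\<close>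

lemma ext_of_wedge_swap:
  "ext_of u * (prod_list (map ext_of vs) * ext_of v) =
     - (ext_of v * (prod_list (map ext_of vs) * ext_of u))"
  using ext_of_wedge_repeat[of "u + v" vs]
  by (simp add: ext_of_add distrib_left distrib_right ext_of_wedge_repeat eq_neg_iff_add_eq_0 add.commute)

text \<open>Positions descend from \<open>k - 1\<close> to \<open>0\<close>, the order of the
  factors both in \<open>wedge_beta\<close> and in the product of the series.\<close>

definition wedge :: "nat \<Rightarrow> (nat \<Rightarrow> vdual) \<Rightarrow> ext" where
  "wedge k f = prod_list (map (\<lambda>r. ext_of (f r)) (rev [0..<k]))"

lemma wedge_cong: "(\<And>r. r < k \<Longrightarrow> f r = g r) \<Longrightarrow> wedge k f = wedge k g"
  unfolding wedge_def by (intro arg_cong[where f = prod_list] map_cong) auto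

text \<open>Isolates two positions, in the shape that \<open>ext_of_wedge_repeat\<close> and
  \<open>ext_of_wedge_swap\<close> require.\<close>

lemma wedge_split:
  assumes "a < b" "b < k"
  shows "wedge k f = prod_list (map (\<lambda>r. ext_of (f r)) (rev [Suc b..<k])) *
    (ext_of (f b) * (prod_list (map ext_of (map f (rev [Suc a..<b]))) * ext_of (f a))) *
    prod_list (map (\<lambda>r. ext_of (f r)) (rev [0..<a]))"
proof -
  have "[0..<k] = [0..<a] @ a # [Suc a..<b] @ b # [Suc b..<k]"
    using assms upt_add_eq_append[of 0 a "k - a"] upt_add_eq_append[of "Suc a" b "k - b"]
    by (simp add: upt_conv_Cons)
  then show ?thesis
    by (simp add: wedge_def mult.assoc comp_def)
qed

lemma wedge_eq_0:
  assumes "\<not> inj_on f {0..<k}"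
  shows "wedge k f = 0"
proof -
  obtain a b where "a < b" "b < k" "f a = f b"
    using assms by (auto simp: inj_on_def) (metis linorder_neqE_nat)
  then show ?thesis
    by (simp add: wedge_split[of a b k f] ext_of_wedge_repeat del: map_map)
qed

lemma wedge_transpose:
  assumes "a < k" "b < k" "a \<noteq> b"
  shows "wedge k (f \<circ> Transposition.transpose a b) = - wedge k f"
proof -
  have *: "wedge k (f \<circ> Transposition.transpose a b) = - wedge k f" if "a < b" "b < k" for a b
  proof -
    let ?t = "Transposition.transpose a b"
    have eq: "map (\<lambda>r. ext_of ((f \<circ> ?t) r)) (rev [Suc b..<k]) = map (\<lambda>r. ext_of (f r)) (rev [Suc b..<k])"
      "map (\<lambda>r. ext_of ((f \<circ> ?t) r)) (rev [0..<a]) = map (\<lambda>r. ext_of (f r)) (rev [0..<a])"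
      "map (f \<circ> ?t) (rev [Suc a..<b]) = map f (rev [Suc a..<b])"
      using that by (auto simp: Transposition.transpose_def)
    show ?thesis
      unfolding wedge_split[OF that] eq
      by (simp add: ext_of_wedge_swap[of "f a" _ "f b"] del: map_map)
  qed
  show ?thesis
    using *[of a b] *[of b a] assms by (metis linorder_neqE_nat transpose_commute)
qed

text \<open>Transpositions are composed on the right, so that each exchanges two positions in the
  wedge of \<open>f \<circ> p\<close>.\<close>

lemma wedge_permute:
  assumes "p permutes {0..<k}"
  shows "wedge k (f \<circ> p) = of_int (sign p) * wedge k f"
  using finite_atLeastLessThan assms
proof (induction rule: permutes_rev_induct)
  case (swap a b p)
  have "permutation p"
    using swap.hyps by (auto simp: permutation_permutes)
  then have "sign (p \<circ> Transposition.transpose a b) = - sign p"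
    using swap.hyps by (simp add: sign_compose permutation_swap_id sign_swap_id)
  then show ?case
    using swap wedge_transpose[of a k b "f \<circ> p"] by (simp add: o_assoc del: comp_apply o_apply)
qed simp

section \<open>Coefficients of the generating series\<close>

lemma mfps_eqI: "(\<And>m. mfps_nth F m = mfps_nth G m) \<Longrightarrow> F = G"
  by (metis ext mfps_nth_inject)

lemma mfps_nth_formal_sum:
  assumes "finite S" "S \<subseteq> A" "\<And>x. x \<in> A \<Longrightarrow> mfps_nth (F x) m \<noteq> 0 \<Longrightarrow> x \<in> S"
  shows "mfps_nth (formal_sum A F) m = (\<Sum>x\<in>S. mfps_nth (F x) m)"
  unfolding formal_sum_def Abs_mfps_inverse[OF UNIV_I]
  by (rule sum.mono_neutral_left) (use assms in auto)

text \<open>Only finitely many exponents divide \<open>m\<close>, so by local finiteness one finite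
  index set serves them all and two finite sums can be interchanged.\<close>

lemma formal_sum_mult_left:
  assumes "\<And>m. finite {x \<in> A. mfps_nth (F x) m \<noteq> 0}"
  shows "G * formal_sum A F = formal_sum A (\<lambda>x. G * F x)"
proof (rule mfps_eqI)
  fix m
  let ?S = "\<Union>b\<in>snd ` antidiag m. {x \<in> A. mfps_nth (F x) b \<noteq> 0}"
  have fin: "finite ?S"
    using assms finite_antidiag by blast
  have "mfps_nth (formal_sum A F) b = (\<Sum>x\<in>?S. mfps_nth (F x) b)" if "(a, b) \<in> antidiag m" for a b
    by (rule mfps_nth_formal_sum[OF fin]) (use that in \<open>force+\<close>)
  then have "mfps_nth (G * formal_sum A F) m =
      (\<Sum>(a, b)\<in>antidiag m. \<Sum>x\<in>?S. mfps_nth G a * mfps_nth (F x) b)"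
    by (auto simp: times_mfps.rep_eq sum_distrib_left intro!: sum.cong)
  also have "\<dots> = (\<Sum>x\<in>?S. mfps_nth (G * F x) m)"
    unfolding case_prod_beta times_mfps.rep_eq by (rule sum.swap)
  also have "\<dots> = mfps_nth (formal_sum A (\<lambda>x. G * F x)) m"
  proof (rule mfps_nth_formal_sum[OF fin, symmetric])
    fix x assume x: "x \<in> A" "mfps_nth (G * F x) m \<noteq> 0"
    then obtain a b where "(a, b) \<in> antidiag m" "mfps_nth G a * mfps_nth (F x) b \<noteq> 0"
      unfolding times_mfps.rep_eq by (auto elim: sum.not_neutral_contains_not_neutral)
    then have "b \<in> snd ` antidiag m" "mfps_nth (F x) b \<noteq> 0"
      by force+
    then show "x \<in> ?S"
      using x by blast
  qed blast
  finally show "mfps_nth (G * formal_sum A F) m = mfps_nth (formal_sum A (\<lambda>x. G * F x)) m" .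
qed

lemma mfps_nth_scaled_const:
  "mfps_nth (mfps_of_mpoly p * mfps_monom 0 c) m = ext_scalar (Poly_Mapping.lookup p m) * c"
  by (simp add: times_mfps.rep_eq mfps_of_mpoly_def mfps_monom_def Abs_mfps_inverse
      if_distrib[of "\<lambda>x. _ * x"] antidiag_zero_right cong: if_cong)

lemma mfps_nth_beta_series:
  "mfps_nth (beta_series i) m =
     (if m = Poly_Mapping.single i (Poly_Mapping.lookup m i)
      then ext_of (\<beta> (Poly_Mapping.lookup m i)) else 0)"
proof -
  have "mfps_nth (beta_series i) m = (\<Sum>j\<in>{Poly_Mapping.lookup m i}.
      mfps_nth (mfps_monom (Poly_Mapping.single i j) (ext_of (\<beta> j))) m)"
    unfolding beta_series_def
    by (rule mfps_nth_formal_sum) (auto simp: mfps_monom_def Abs_mfps_inverse split: if_splits)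
  then show ?thesis
    by (simp add: mfps_monom_def Abs_mfps_inverse)
qed

text \<open>As the variables are distinct, only one splitting of \<open>m\<close> can contribute to
  each convolution: the power of the first variable and the rest.\<close>

lemma mfps_nth_prod_beta_series:
  "distinct js \<Longrightarrow> mfps_nth (prod_list (map beta_series js)) m =
     (if Poly_Mapping.keys m \<subseteq> set js
      then prod_list (map (\<lambda>i. ext_of (\<beta> (Poly_Mapping.lookup m i))) js) else 0)"
proof (induction js arbitrary: m)
  case Nil
  then show ?case by (simp add: one_mfps.rep_eq)
next
  case (Cons i js)
  let ?P = "prod_list (map beta_series js)"
  let ?a = "Poly_Mapping.single i (Poly_Mapping.lookup m i)" and ?b = "Poly_Mapping.update i 0 m"
  have keys_b: "Poly_Mapping.keys ?b = Poly_Mapping.keys m - {i}"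
    by (auto simp: in_keys_iff lookup_update split: if_splits)
  have ab: "?a + ?b = m"
    by (rule poly_mapping_eqI) (auto simp: lookup_add lookup_update lookup_single when_def)
  have unique: "a = ?a \<and> b = ?b"
    if "a + b = m" "mfps_nth (beta_series i) a * mfps_nth ?P b \<noteq> 0" for a b
  proof -
    have a: "a = Poly_Mapping.single i (Poly_Mapping.lookup a i)" and b: "Poly_Mapping.keys b \<subseteq> set js"
      using that(2) Cons by (auto simp: mfps_nth_beta_series split: if_splits)
    have "Poly_Mapping.lookup b i = 0"
      using b Cons.prems by (auto simp: in_keys_iff)
    moreover from this have "Poly_Mapping.lookup a i = Poly_Mapping.lookup m i"
      using that(1) by (auto simp: lookup_add)
    ultimately show ?thesis
      using a that(1) by (metis (no_types, lifting) ab add_left_imp_eq)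
  qed
  have "mfps_nth (beta_series i * ?P) m = (\<Sum>(a, b)\<in>{(?a, ?b)}. mfps_nth (beta_series i) a * mfps_nth ?P b)"
    unfolding times_mfps.rep_eq
  proof (rule sum.mono_neutral_right[OF finite_antidiag])
    show "{(?a, ?b)} \<subseteq> antidiag m"
      using ab by (simp add: antidiag_def)
    show "\<forall>x\<in>antidiag m - {(?a, ?b)}.
        (case x of (a, b) \<Rightarrow> mfps_nth (beta_series i) a * mfps_nth ?P b) = 0"
      using unique by (fastforce simp: antidiag_def)
  qed
  also have "\<dots> = ext_of (\<beta> (Poly_Mapping.lookup m i)) * mfps_nth ?P ?b"
    by (simp add: mfps_nth_beta_series)
  also have "mfps_nth ?P ?b = (if Poly_Mapping.keys m \<subseteq> set (i # js)
      then prod_list (map (\<lambda>i. ext_of (\<beta> (Poly_Mapping.lookup m i))) js) else 0)"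
  proof -
    have eq: "map (\<lambda>j. ext_of (\<beta> (Poly_Mapping.lookup ?b j))) js =
        map (\<lambda>j. ext_of (\<beta> (Poly_Mapping.lookup m j))) js"
      using Cons.prems by (auto simp: lookup_update)
    show ?thesis
      using Cons.prems by (simp add: Cons.IH keys_b Diff_subset_conv eq)
  qed
  finally show ?case by simp
qed

section \<open>Monomials of alternants and shifted partitions\<close>

lemma X_power: "X i ^ n = Poly_Mapping.single (Poly_Mapping.single i n) 1"
  by (induction n) (simp_all add: X_def mult_single flip: single_add)

lemma prod_single: "(\<Prod>x\<in>A. Poly_Mapping.single (f x) (1::rat)) = Poly_Mapping.single (\<Sum>x\<in>A. f x) 1"
  by (induction A rule: infinite_finite_induct) (simp_all add: mult_single)

text \<open>The partition plus the staircase, read from the smallest part: both the exponent in row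
  \<open>r\<close> of the alternant and the index of the wedge factor at position
  \<open>r\<close>.\<close>

definition shifted_part :: "nat \<Rightarrow> nat list \<Rightarrow> nat \<Rightarrow> nat" where
  "shifted_part k \<nu> r = part \<nu> (k - r) + r"

lemma wedge_beta_eq_wedge: "wedge_beta k \<nu> = wedge k (\<lambda>r. \<beta> (shifted_part k \<nu> r))"
  unfolding wedge_beta_def wedge_def shifted_part_def
  by (intro arg_cong[where f = prod_list] nth_equalityI)
     (auto simp: rev_nth algebra_simps simp del: upt_Suc)

lemma strict_mono_on_shifted_part:
  assumes "is_partition k \<nu>"
  shows "strict_mono_on {0..<k} (shifted_part k \<nu>)"
proof (rule strict_mono_onI)
  fix r s assume "r \<in> {0..<k}" "s \<in> {0..<k}" "r < s"
  then have "\<nu> ! (k - s - 1) \<ge> \<nu> ! (k - r - 1)"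
    using assms by (auto simp: is_partition_def sorted_wrt_iff_nth_less)
  then show "shifted_part k \<nu> r < shifted_part k \<nu> s"
    using \<open>r < s\<close> by (simp add: shifted_part_def part_def)
qed

lemma shifted_part_inject:
  assumes "is_partition k \<nu>" "is_partition k \<mu>"
    and "\<And>r. r < k \<Longrightarrow> shifted_part k \<nu> r = shifted_part k \<mu> r"
  shows "\<nu> = \<mu>"
proof (rule nth_equalityI)
  fix i assume "i < length \<nu>"
  then show "\<nu> ! i = \<mu> ! i"
    using assms(3)[of "k - Suc i"] assms(1) by (simp add: is_partition_def shifted_part_def part_def)
qed (use assms in \<open>simp add: is_partition_def\<close>)

text \<open>Subtracting the staircase inverts the shift.\<close>

lemma shifted_part_surj:
  assumes "strict_mono_on {0..<k} a"
  obtains \<nu> where "is_partition k \<nu>" "\<And>r. r < k \<Longrightarrow> shifted_part k \<nu> r = a r"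
proof
  let ?\<nu> = "map (\<lambda>i. a (k - Suc i) - (k - Suc i)) [0..<k]"
  have Suc: "a s < a (Suc s)" if "Suc s < k" for s
    using assms that by (auto simp: strict_mono_on_def)
  \<comment> \<open>This keeps the natural subtraction in \<open>?\<nu>\<close> from
    truncating.\<close>
  have ge: "s \<le> a s" if "s < k" for s
    using that by (induction s) (use Suc in fastforce)+
  have step: "a r - r \<le> a s - s" if "r \<le> s" "s < k" for r s
    using that
  proof (induction s rule: dec_induct)
    case (step s)
    then show ?case
      using Suc[of s] by simp
  qed simp
  have "a (k - Suc j) - (k - Suc j) \<le> a (k - Suc i) - (k - Suc i)" if "i < j" "j < k" for i j
    by (rule step) (use that in auto)
  then show "is_partition k ?\<nu>"
    by (simp add: is_partition_def sorted_wrt_iff_nth_less)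
  show "shifted_part k ?\<nu> r = a r" if "r < k" for r
    using that ge[of r] by (simp add: shifted_part_def part_def)
qed

text \<open>The matrix entries are powers of variables, so each Leibniz term is a single signed
  monomial.\<close>

lemma lookup_alternant_X:
  "Poly_Mapping.lookup (alternant k \<nu> X) m =
     (\<Sum>p\<in>{p. p permutes {0..<k}}. if Poly_Mapping.keys m \<subseteq> {1..k} \<and>
        (\<forall>r<k. Poly_Mapping.lookup m (Suc (p r)) = shifted_part k \<nu> r) then of_int (sign p) else 0)"
proof -
  let ?M = "\<lambda>p. \<Sum>r = 0..<k. Poly_Mapping.single (Suc (p r)) (shifted_part k \<nu> r)"
  have iff: "m = ?M p \<longleftrightarrow> Poly_Mapping.keys m \<subseteq> {1..k} \<and>
      (\<forall>r<k. Poly_Mapping.lookup m (Suc (p r)) = shifted_part k \<nu> r)"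
    if p: "p permutes {0..<k}" for p
  proof -
    \<comment> \<open>By injectivity of \<open>p\<close>, only row \<open>r\<close> affects the
      variable \<open>Suc (p r)\<close>.\<close>
    have at_p: "Poly_Mapping.lookup (?M p) (Suc (p r)) = shifted_part k \<nu> r" if "r < k" for r
    proof -
      have "Poly_Mapping.lookup (?M p) (Suc (p r)) =
          (\<Sum>s = 0..<k. if s = r then shifted_part k \<nu> s else 0)"
        unfolding lookup_sum lookup_single
        by (rule sum.cong) (auto simp: when_def dest: inj_onD[OF permutes_inj[OF p]])
      then show ?thesis using that by simp
    qed
    have outside: "Poly_Mapping.lookup (?M p) i = 0" if "i \<notin> {1..k}" for i
    proof -
      have "p s < k" if "s < k" for s
        using permutes_in_image[OF p, of s] that by simp
      then show ?thesis
        using that unfolding lookup_sum lookup_single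
        by (intro sum.neutral) (auto simp: when_def Suc_le_eq)
    qed
    show ?thesis
    proof
      assume "m = ?M p"
      then show "Poly_Mapping.keys m \<subseteq> {1..k} \<and>
          (\<forall>r<k. Poly_Mapping.lookup m (Suc (p r)) = shifted_part k \<nu> r)"
        using at_p outside by (metis in_keys_iff subsetI)
    next
      assume R: "Poly_Mapping.keys m \<subseteq> {1..k} \<and>
          (\<forall>r<k. Poly_Mapping.lookup m (Suc (p r)) = shifted_part k \<nu> r)"
      show "m = ?M p"
      proof (rule poly_mapping_eqI)
        fix i
        show "Poly_Mapping.lookup m i = Poly_Mapping.lookup (?M p) i"
        proof (cases "i \<in> {1..k}")
          case True
          \<comment> \<open>By surjectivity of \<open>p\<close>, the condition fixes the exponent of
            every variable up to \<open>k\<close>.\<close>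
          then have "i - 1 \<in> p ` {0..<k}"
            using permutes_image[OF p] by auto
          then obtain r where "r < k" "i = Suc (p r)"
            using True by auto
          then show ?thesis
            using R at_p by simp
        next
          case False
          then have "Poly_Mapping.lookup m i = 0"
            using R by (meson in_keys_iff subsetD)
          then show ?thesis
            using outside[OF False] by simp
        qed
      qed
    qed
  qed
  have "alternant k \<nu> X = (\<Sum>p | p permutes {0..<k}. signof p * Poly_Mapping.single (?M p) 1)"
    unfolding alternant_altdef
    by (subst det_def'[of _ k])
       (auto simp: X_power prod_single shifted_part_def permutes_def intro!: sum.cong prod.cong)
  moreover have "Poly_Mapping.lookup (signof p * Poly_Mapping.single (?M p) (1::rat)) m =
      (if m = ?M p then of_int (sign p) else 0)" for p
    by (cases "sign p = 1") (auto simp: sign_def lookup_single when_def)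
  ultimately show ?thesis
    by (simp only: lookup_sum) (rule sum.cong; simp only: iff mem_Collect_eq)
qed

text \<open>Send \<open>r\<close> to the position of the value of rank \<open>r\<close>, counted
  from 0. Uniqueness holds because a finite set has only one strictly increasing
  enumeration.\<close>

lemma sorting_permutation:
  fixes f :: "nat \<Rightarrow> 'a::linorder"
  assumes inj: "inj_on f {0..<k}"
  obtains p where "p permutes {0..<k}" "strict_mono_on {0..<k} (f \<circ> p)"
    "\<And>q. q permutes {0..<k} \<Longrightarrow> strict_mono_on {0..<k} (f \<circ> q) \<Longrightarrow> q = p"
proof -
  define xs where "xs = sorted_list_of_set (f ` {0..<k})"
  have xs: "length xs = k" "set xs = f ` {0..<k}" "distinct xs" "sorted_wrt (<) xs"
    using inj by (simp_all add: xs_def card_image)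
  define p where "p r = (if r < k then the_inv_into {0..<k} f (xs ! r) else r)" for r
  have fp: "f (p r) = xs ! r" if "r < k" for r
    using that xs inj by (auto simp: p_def intro!: f_the_inv_into_f)
       (metis nth_mem)
  have "bij_betw ((!) xs) {0..<k} (f ` {0..<k})"
    using bij_betw_nth[of xs "{..<k}" "f ` {0..<k}"] xs by (simp add: atLeast0LessThan)
  moreover have "bij_betw (the_inv_into {0..<k} f) (f ` {0..<k}) {0..<k}"
    using inj by (simp add: bij_betw_the_inv_into inj_on_imp_bij_betw)
  ultimately have "bij_betw (the_inv_into {0..<k} f \<circ> (!) xs) {0..<k} {0..<k}"
    by (rule bij_betw_trans)
  then have "bij_betw p {0..<k} {0..<k}"
    by (rule bij_betw_cong[THEN iffD1, rotated]) (simp add: p_def)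
  then have p: "p permutes {0..<k}"
    by (rule bij_imp_permutes) (simp add: p_def)
  have mono: "strict_mono_on {0..<k} (f \<circ> p)"
    using xs fp by (auto simp: strict_mono_on_def sorted_wrt_iff_nth_less)
  have "q = p" if q: "q permutes {0..<k}" and "strict_mono_on {0..<k} (f \<circ> q)" for q
  proof
    fix r
    have "sorted_wrt (<) (map (f \<circ> q) [0..<k])"
      using that by (auto simp: sorted_wrt_iff_nth_less strict_mono_on_def)
    moreover have "set (map (f \<circ> q) [0..<k]) = set xs"
      using permutes_image[OF q] xs by (simp add: image_image[of f q, symmetric] comp_def)
    ultimately have "map (f \<circ> q) [0..<k] = xs"
      using strict_sorted_equal xs by metis
    then have "f (q r) = f (p r)" if "r < k"
      using fp that by auto
    then show "q r = p r"
      using inj permutes_in_image[OF p, of r] permutes_in_image[OF q, of r]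
        permutes_not_in[OF p, of r] permutes_not_in[OF q, of r]
      by (cases "r < k") (auto dest: inj_onD)
  qed
  with that p mono show ?thesis by blast
qed

lemma ext_scalar_sign: "ext_scalar (of_int (sign p)) = of_int (sign p)"
  using ext_scalar_add[of 1 "- 1"]
  by (auto simp: sign_def ext_scalar_1 ext_scalar_0 eq_neg_iff_add_eq_0 add.commute)

lemma formal_sum_alternant:
  "formal_sum {\<nu>. is_partition k \<nu>}
     (\<lambda>\<nu>. mfps_of_mpoly (alternant k \<nu> X) * mfps_monom 0 (wedge_beta k \<nu>)) =
   prod_list (map beta_series (rev [1..<Suc k]))"
proof (rule mfps_eqI)
  fix m :: "nat \<Rightarrow>\<^sub>0 nat"
  let ?F = "\<lambda>\<nu>. mfps_of_mpoly (alternant k \<nu> X) * mfps_monom 0 (wedge_beta k \<nu>)"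
  define f where "f r = Poly_Mapping.lookup m (Suc r)" for r
  have keys: "set (rev [1..<Suc k]) = {1..k}" by auto
  have shift: "rev [1..<Suc k] = map Suc (rev [0..<k])"
    by (simp add: rev_map[symmetric] map_Suc_upt del: upt_Suc)
  have rhs: "mfps_nth (prod_list (map beta_series (rev [1..<Suc k]))) m =
      (if Poly_Mapping.keys m \<subseteq> {1..k} then wedge k (\<beta> \<circ> f) else 0)"
    unfolding mfps_nth_prod_beta_series[OF iffD2[OF distinct_rev distinct_upt]] keys
    by (simp only: shift map_map wedge_def comp_def f_def)
  \<comment> \<open>A contributing permutation must sort the exponents, since shifted parts increase
    strictly.\<close>
  have perm_iff: "p permutes {0..<k} \<and> (\<forall>r<k. f (p r) = shifted_part k \<nu> r) \<Longrightarrow>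
      strict_mono_on {0..<k} (f \<circ> p)" if "is_partition k \<nu>" for p \<nu>
    using strict_mono_on_shifted_part[OF that] by (auto simp: strict_mono_on_def)
  show "mfps_nth (formal_sum {\<nu>. is_partition k \<nu>} ?F) m =
      mfps_nth (prod_list (map beta_series (rev [1..<Suc k]))) m"
  proof (cases "Poly_Mapping.keys m \<subseteq> {1..k} \<and> inj_on f {0..<k}")
    case True
    obtain p where p: "p permutes {0..<k}" "strict_mono_on {0..<k} (f \<circ> p)"
      and p_unique: "\<And>q. q permutes {0..<k} \<Longrightarrow> strict_mono_on {0..<k} (f \<circ> q) \<Longrightarrow> q = p"
      using sorting_permutation True by blast
    \<comment> \<open>The sorted exponents are the shifted parts of a partition.\<close>
    obtain \<mu> where \<mu>: "is_partition k \<mu>" "\<And>r. r < k \<Longrightarrow> shifted_part k \<mu> r = f (p r)"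
      using shifted_part_surj[OF p(2)] by auto
    have coeff: "Poly_Mapping.lookup (alternant k \<nu> X) m = (if \<nu> = \<mu> then of_int (sign p) else 0)"
      if \<nu>: "is_partition k \<nu>" for \<nu>
    proof -
      have match: "(\<forall>r<k. f (q r) = shifted_part k \<nu> r) \<longleftrightarrow> q = p \<and> \<nu> = \<mu>"
        if "q permutes {0..<k}" for q
        using perm_iff[OF \<nu>, of q] p_unique[of q] that \<mu> shifted_part_inject[OF \<nu> \<mu>(1)] by auto
      have "Poly_Mapping.lookup (alternant k \<nu> X) m =
          (\<Sum>q\<in>{q. q permutes {0..<k}}. if q = p then if \<nu> = \<mu> then of_int (sign p) else 0 else 0)"
        unfolding lookup_alternant_X f_def[symmetric] using True match by (intro sum.cong) auto
      then show ?thesis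
        using p(1) by (simp add: finite_permutations)
    qed
    have "mfps_nth (formal_sum {\<nu>. is_partition k \<nu>} ?F) m = (\<Sum>\<nu>\<in>{\<mu>}. mfps_nth (?F \<nu>) m)"
      by (rule mfps_nth_formal_sum)
         (use \<mu> in \<open>auto simp: mfps_nth_scaled_const coeff ext_scalar_0 split: if_splits\<close>)
    also have "\<dots> = of_int (sign p) * wedge k ((\<beta> \<circ> f) \<circ> p)"
      using \<mu> by (simp add: mfps_nth_scaled_const coeff ext_scalar_sign wedge_beta_eq_wedge
          cong: wedge_cong)
    \<comment> \<open>Sorting the wedge yields the same sign as the alternant, and the two multiply
      to 1.\<close>
    also have "\<dots> = wedge k (\<beta> \<circ> f)"
      unfolding wedge_permute[OF p(1)] mult.assoc[symmetric] of_int_mult[symmetric] by simp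
    finally show ?thesis
      using True unfolding rhs by simp
  next
    \<comment> \<open>A foreign variable kills both sides. If two exponents agree, no permutation
      sorts them strictly, and the wedge has a repeated factor.\<close>
    case False
    have "Poly_Mapping.lookup (alternant k \<nu> X) m = 0" if \<nu>: "is_partition k \<nu>" for \<nu>
      unfolding lookup_alternant_X f_def[symmetric]
    proof (rule sum.neutral, safe)
      fix q assume q: "q permutes {0..<k}"
      have "inj_on f {0..<k}" if "\<forall>r<k. f (q r) = shifted_part k \<nu> r"
        using strict_mono_on_imp_inj_on[OF perm_iff[OF \<nu>, of q]] q that
          permutes_image[OF q] inj_on_imageI[of f q "{0..<k}"] by simp
      then show "(if Poly_Mapping.keys m \<subseteq> {1..k} \<and> (\<forall>r<k. f (q r) = shifted_part k \<nu> r)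
          then of_int (sign q) else 0) = (0::rat)"
        using False by auto
    qed
    then have "mfps_nth (formal_sum {\<nu>. is_partition k \<nu>} ?F) m = (\<Sum>\<nu>\<in>{}. mfps_nth (?F \<nu>) m)"
      by (intro mfps_nth_formal_sum) (auto simp: mfps_nth_scaled_const ext_scalar_0)
    moreover have "\<not> inj_on (\<beta> \<circ> f) {0..<k}" if "\<not> inj_on f {0..<k}"
      using that inj_on_imageI2 by blast
    ultimately show ?thesis
      using False wedge_eq_0[of "\<beta> \<circ> f" k] unfolding rhs by auto
  qed
qed

section \<open>Clearing the Vandermonde denominator\<close>

theorem lemma7p3:
  fixes k :: nat
  assumes "k \<ge> 1"
  shows "frac_series_of
           (formal_sum {\<nu>. is_partition k \<nu>}
              (\<lambda>\<nu>. mfps_of_mpoly (schur k \<nu>) * mfps_monom 0 (wedge_beta k \<nu>))) =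
         frac_scale ((- 1) ^ (k * (k - 1) div 2) * ((\<Prod>j = 1..k. w j ^ (k - 1)) / vandermonde k w))
           (frac_series_of (prod_list (map beta_series (rev [1..<Suc k]))))"
proof -
  let ?F = "\<lambda>\<nu>. mfps_of_mpoly (schur k \<nu>) * mfps_monom 0 (wedge_beta k \<nu>)"
  let ?V = "vandermonde k X"
  \<comment> \<open>Needed to multiply the sum termwise by \<open>?V\<close>. The largest part is at
    most the degree of \<open>m\<close>, which leaves finitely many partitions.\<close>
  have locally_finite: "finite {\<nu> \<in> {\<nu>. is_partition k \<nu>}. mfps_nth (?F \<nu>) m \<noteq> 0}" for m
  proof (rule finite_subset)
    show "{\<nu> \<in> {\<nu>. is_partition k \<nu>}. mfps_nth (?F \<nu>) m \<noteq> 0} \<subseteq>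
        {\<nu>. set \<nu> \<subseteq> {..mdeg m} \<and> length \<nu> = k}"
    proof safe
      fix \<nu> assume \<nu>: "is_partition k \<nu>" and "mfps_nth (?F \<nu>) m \<noteq> 0"
      then have "Poly_Mapping.lookup (schur k \<nu>) m \<noteq> 0"
        by (auto simp: mfps_nth_scaled_const ext_scalar_0)
      then have "part \<nu> 1 \<le> mdeg m"
        using order_ge_schur[OF assms, of \<nu>] by (auto simp: order_ge_def in_keys_iff)
      moreover have "\<nu> ! i \<le> \<nu> ! 0" if "i < k" for i
        using \<nu> that by (cases "i = 0") (auto simp: is_partition_def sorted_wrt_iff_nth_less)
      ultimately show "x \<le> mdeg m" if "x \<in> set \<nu>" for x
        using that \<nu> by (force simp: in_set_conv_nth is_partition_def part_def)
      show "length \<nu> = k"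
        using \<nu> by (simp add: is_partition_def)
    qed
  qed (simp add: finite_lists_length_eq)
  have "mfps_of_mpoly ?V * formal_sum {\<nu>. is_partition k \<nu>} ?F =
      formal_sum {\<nu>. is_partition k \<nu>}
        (\<lambda>\<nu>. mfps_of_mpoly (alternant k \<nu> X) * mfps_monom 0 (wedge_beta k \<nu>))"
    unfolding formal_sum_mult_left[OF locally_finite] mfps_of_mpoly_act
    by (simp add: alternant_eq_schur_dd schur_eq_schur_dd mult.commute)
  also have "\<dots> = prod_list (map beta_series (rev [1..<Suc k]))"
    by (rule formal_sum_alternant)
  \<comment> \<open>The identity holds before localisation, so \<open>u = 1\<close> is a witness for
    equality of the fractions.\<close>
  finally show ?thesis
    unfolding vandermonde_prefactor frac_series_of_eq_scale_iff[OF vandermonde_X_nonzero]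
    by (intro exI[of _ 1]) (simp add: mfps_of_mpoly_1 del: upt_Suc)
qed

end
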